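(* Let $n\ge 3$ and let $C=(\mathbb{Z}_n,E)$ be the cycle with $E=\{\{u,u+1\}:u\in\mathbb{Z}_n\}$. Let $0\le k\le n-3$ and let $v_0,\dots,v_{k+1}\in\mathbb{Z}_n$ be distinct such that $\langle v_0,\dots,v_{k+1}\rangle$ is true to $C$. For $i=1,\dots,k$ let $m_i\in\mathbb{N}$ be odd and let $w_i^1,\dots,w_i^{m_i}\in\,]v_{k+1},v_0[$ be distinct with $\langle w_i^1,\dots,w_i^{m_i}\rangle$ true to $C$, and such that $w_{i+1}^{m_{i+1}}\in\,]v_{k+1},w_i^1]$ for $i=1,\dots,k-1$. Then the star-glider inequality $$\sum_{i=0}^{k}x_{v_iv_{i+1}}+\sum_{i=1}^{k}\sum_{j=1}^{m_i}(-1)^j x_{v_iw_i^j}\le 1$$ defines a facet of $\mathrm{LMC}(C)$.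
   Context: $\mathbb{Z}_n$ is the ring of integers modulo $n$. For $a,b\in\mathbb{Z}_n$, $[a,b]=\{a,a+1,\dots,b\}$ (forward around the cycle), $]a,b[\,=[a,b]\setminus\{a,b\}$, $[a,b[\,=[a,b]\setminus\{b\}$, $]a,b]=[a,b]\setminus\{a\}$. A cyclic sequence $\langle u_0,\dots,u_{p-1}\rangle$ of nodes (i.e. $u:\mathbb{Z}_p\to\mathbb{Z}_n$) is true to $C$ if either $u_i\in[u_0,u_{i+1}[$ for all $i=0,\dots,p-2$, or $u_i\in\,]u_{i+1},u_0]$ for all $i=0,\dots,p-2$. A decomposition of $C$ is a partition of $\mathbb{Z}_n$ whose blocks induce connected subgraphs of $C$; its lifted multicut is the set of pairs $ab\in\binom{\mathbb{Z}_n}{2}$ with $a,b$ in distinct blocks. $\mathrm{LMC}(C)\subseteq\mathbb{R}^{\binom{\mathbb{Z}_n}{2}}$ is the convex hull of the characteristic vectors of these lifted multicuts over all decompositions of $C$.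
   Formalization: Added for i=1..k: the cyclic sequence ⟨v_0,…,v_{k+1},w_i^1,…,w_i^{m_i}⟩ is true to C. Without it the claim fails, e.g. n=4, k=1, v=(0,2,1), w_1=(3): the decomposition {2,3},{0},{1} gives value 2. *)

theory Defs
  imports
    "HOL-Analysis.Analysis"
    "HOL-Library.Disjoint_Sets"
    "Berlekamp_Zassenhaus.Finite_Field"
begin

text \<open>The ring of integers modulo \<open>n\<close> is \<open>'n mod_ring\<close> with \<open>n = CARD('n)\<close>; the class \<open>nontriv\<close>
  only says \<open>n > 1\<close>, which is needed for it to be a ring with \<open>1 \<noteq> 0\<close>.\<close>

subsection \<open>Intervals of the cycle\<close>

text \<open>\<open>to_int_mod_ring (b - a)\<close>, the representative of \<open>b - a\<close> in \<open>{0..<n}\<close>, is the number of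
  forward steps from \<open>a\<close> to \<open>b\<close>. In particular \<open>cyc_cc a a = {a}\<close>.
  In the names, c and o stand for a closed and an open end.\<close>

definition cyc_cc :: "'n::nontriv mod_ring \<Rightarrow> 'n mod_ring \<Rightarrow> 'n mod_ring set" where
  "cyc_cc a b = {a + of_nat t | t. t \<le> nat (to_int_mod_ring (b - a))}"

definition cyc_oo :: "'n::nontriv mod_ring \<Rightarrow> 'n mod_ring \<Rightarrow> 'n mod_ring set" where
  "cyc_oo a b = cyc_cc a b - {a, b}"

definition cyc_co :: "'n::nontriv mod_ring \<Rightarrow> 'n mod_ring \<Rightarrow> 'n mod_ring set" where
  "cyc_co a b = cyc_cc a b - {b}"

definition cyc_oc :: "'n::nontriv mod_ring \<Rightarrow> 'n mod_ring \<Rightarrow> 'n mod_ring set" where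
  "cyc_oc a b = cyc_cc a b - {a}"

text \<open>\<open>true_to_cycle p u\<close>: the cyclic sequence \<open>\<langle>u 0, \<dots>, u (p - 1)\<rangle>\<close> is true to the cycle.\<close>

definition true_to_cycle :: "nat \<Rightarrow> (nat \<Rightarrow> 'n::nontriv mod_ring) \<Rightarrow> bool" where
  "true_to_cycle p u \<longleftrightarrow>
     (\<forall>i. Suc i < p \<longrightarrow> u i \<in> cyc_co (u 0) (u (Suc i))) \<or>
     (\<forall>i. Suc i < p \<longrightarrow> u i \<in> cyc_oc (u (Suc i)) (u 0))"

subsection \<open>Decompositions of the cycle\<close>

definition cycle_edges :: "'n::nontriv mod_ring set set" where
  "cycle_edges = {{u, u + 1} | u. True}"

definition induces_connected :: "'n::nontriv mod_ring set \<Rightarrow> bool" where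
  "induces_connected B \<longleftrightarrow>
     (\<forall>a\<in>B. \<forall>b\<in>B. (\<lambda>x y. x \<in> B \<and> y \<in> B \<and> {x, y} \<in> cycle_edges)\<^sup>*\<^sup>* a b)"

definition decomposition :: "'n::nontriv mod_ring set set \<Rightarrow> bool" where
  "decomposition P \<longleftrightarrow> partition_on UNIV P \<and> (\<forall>B\<in>P. induces_connected B)"

subsection \<open>The lifted multicut polytope\<close>

typedef (overloaded) 'n node_pair = "{e :: 'n::nontriv mod_ring set. card e = 2}"
proof
  show "{0, 1} \<in> {e :: 'n mod_ring set. card e = 2}" by simp
qed

instance node_pair :: (nontriv) finite
proof
  have "finite (Rep_node_pair ` (UNIV :: 'a node_pair set))" by simp
  then show "finite (UNIV :: 'a node_pair set)"
    by (rule finite_imageD) (simp add: inj_on_def Rep_node_pair_inject)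
qed

text \<open>Only meaningful for \<open>a \<noteq> b\<close>.\<close>

definition node_pair :: "'n::nontriv mod_ring \<Rightarrow> 'n mod_ring \<Rightarrow> 'n node_pair" where
  "node_pair a b = Abs_node_pair {a, b}"

definition lifted_multicut :: "'n::nontriv mod_ring set set \<Rightarrow> 'n node_pair set" where
  "lifted_multicut P =
     {e. \<exists>A\<in>P. \<exists>B\<in>P. A \<noteq> B \<and> (\<exists>a\<in>A. \<exists>b\<in>B. Rep_node_pair e = {a, b})}"

definition char_vec :: "'e::finite set \<Rightarrow> real ^ 'e" where
  "char_vec M = (\<chi> e. if e \<in> M then 1 else 0)"

definition LMC :: "(real ^ 'n::nontriv node_pair) set" where
  "LMC = convex hull {char_vec (lifted_multicut P) | P. decomposition P}"

definition defines_facet :: "('a::euclidean_space \<Rightarrow> real) \<Rightarrow> real \<Rightarrow> 'a set \<Rightarrow> bool" where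
  "defines_facet f c S \<longleftrightarrow> (\<forall>x\<in>S. f x \<le> c) \<and> {x \<in> S. f x = c} facet_of S"

end

theory Submission
  imports Defs
begin

text \<open>
  Number the nodes by their forward distance from \<open>v 0\<close>. For a decomposition, the left-hand side of the
  inequality is \<open>1\<close> minus the sum, over the blocks \<open>B\<close>, of the coefficients of the pairs inside \<open>B\<close>.
  Blocks are arcs of the cycle, and this block weight is nonnegative on every arc, which gives validity.
  For an arc \<open>B\<close> of weight \<open>0\<close>, the decomposition into \<open>B\<close> and singletons lies on the face, and so does the
  decomposition into singletons only. Hence, if a vector \<open>c\<close> is orthogonal to the directions of the face,
  then its entries inside every arc of weight \<open>0\<close> sum to \<open>0\<close>. Differences of such sums over nested arcs
  show that \<open>c\<close> vanishes as soon as its entry at \<open>v 0, v 1\<close> does. So the orthogonal complement has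
  dimension at most one, and the face has codimension one.
\<close>

section \<open>Two facts on finite sums\<close>

lemma alternating_sum: "(\<Sum>j = 1..t. (- 1) ^ j) = (if odd t then - 1 else 0 :: real)"
  by (induction t) auto

text \<open>Since the total vanishes, a zero suffix sum forces the complementary prefix sum to be
  zero too. So all prefix sums vanish, and \<open>G b\<close> is the difference of two of
  them.\<close>

lemma sums_zero_imp_zero:
  fixes G :: "nat \<Rightarrow> real" and n s b :: nat
  assumes total: "(\<Sum>p = s..<n. G p) = 0"
    and part: "\<And>c. s \<le> c \<Longrightarrow> c \<le> n \<Longrightarrow> (\<Sum>p = c..<n. G p) = 0 \<or> (\<Sum>p = s..<c. G p) = 0"
    and "s \<le> b" "b < n"
  shows "G b = 0"
proof -
  have pre: "(\<Sum>p = s..<c. G p) = 0" if "s \<le> c" "c \<le> n" for c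
    using part[OF that] total sum.atLeastLessThan_concat[OF that, of G] by auto
  show ?thesis using pre[of b] pre[of "Suc b"] assms(3,4) by simp
qed

subsection \<open>Weights of arcs\<close>

text \<open>Positions are forward distances from \<open>v 0\<close>, so being true to the cycle
  becomes monotonicity of natural numbers. All \<open>V i\<close> precede all \<open>W i j\<close>,
  and the rows run backwards: each starts no earlier than the next one ends.\<close>

locale star_glider =
  fixes n k :: nat and V :: "nat \<Rightarrow> nat" and m :: "nat \<Rightarrow> nat" and W :: "nat \<Rightarrow> nat \<Rightarrow> nat"
  assumes V_0: "V 0 = 0"
    and V_less_Suc: "i \<le> k \<Longrightarrow> V i < V (Suc i)"
    and V_less_n: "V (Suc k) < n"
    and odd_m: "i \<in> {1..k} \<Longrightarrow> odd (m i)"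
    and V_less_W: "i \<in> {1..k} \<Longrightarrow> j \<in> {1..m i} \<Longrightarrow> V (Suc k) < W i j"
    and W_less_n: "i \<in> {1..k} \<Longrightarrow> j \<in> {1..m i} \<Longrightarrow> W i j < n"
    and W_less_Suc: "i \<in> {1..k} \<Longrightarrow> j \<in> {1..<m i} \<Longrightarrow> W i j < W i (Suc j)"
    and W_last_le_first: "i \<in> {1..<k} \<Longrightarrow> W (Suc i) (m (Suc i)) \<le> W i 1"
begin

definition block_weight :: "nat set \<Rightarrow> real" where
  "block_weight B = (\<Sum>i = 0..k. of_bool (V i \<in> B \<and> V (Suc i) \<in> B))
     + (\<Sum>i = 1..k. \<Sum>j = 1..m i. (- 1) ^ j * of_bool (V i \<in> B \<and> W i j \<in> B))"

text \<open>The coefficients in row \<open>V i\<close> enter the weight of an arc only through these partial sums, which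
  take the values \<open>0\<close> and \<open>- 1\<close>, namely \<open>0\<close> up to \<open>W i 1\<close> and \<open>- 1\<close> beyond \<open>W i (m i)\<close>.\<close>

definition alt_sum :: "nat \<Rightarrow> nat \<Rightarrow> real" where
  "alt_sum i b = (\<Sum>j = 1..m i. (- 1) ^ j * of_bool (W i j < b))"

lemma V_mono: "i < j \<Longrightarrow> j \<le> Suc k \<Longrightarrow> V i < V j"
proof (induction j)
  case (Suc j)
  then show ?case using V_less_Suc[of j] by (cases "i = j") auto
qed simp

lemma V_mono_le: "i \<le> j \<Longrightarrow> j \<le> Suc k \<Longrightarrow> V i \<le> V j"
  using V_mono[of i j] by (cases "i = j") auto

lemma V_le_last: "i \<le> Suc k \<Longrightarrow> V i \<le> V (Suc k)"
  by (rule V_mono_le) auto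

lemma W_mono:
  assumes "i \<in> {1..k}" "1 \<le> j" "j < j'" "j' \<le> m i"
  shows "W i j < W i j'"
  using assms(3,4)
proof (induction j')
  case (Suc j')
  then show ?case using W_less_Suc[OF assms(1), of j'] assms(2) by (cases "j = j'") force+
qed simp

lemma m_pos: "i \<in> {1..k} \<Longrightarrow> 1 \<le> m i"
  using odd_m by (cases "m i") force+

lemma W_bounds:
  assumes "i \<in> {1..k}" "j \<in> {1..m i}"
  shows "W i 1 \<le> W i j" "W i j \<le> W i (m i)"
  using W_mono[OF assms(1), of 1 j] W_mono[OF assms(1), of j "m i"] assms(2)
  by (cases "j = 1"; force) (cases "j = m i"; use W_mono[OF assms(1), of j "m i"] assms(2) in force)

lemma W_first_le_last: "i \<in> {1..k} \<Longrightarrow> W i 1 \<le> W i (m i)"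
  using W_bounds(1)[of i "m i"] m_pos[of i] by auto

lemma W_last_le_first_less:
  assumes "i < i'" "1 \<le> i" "i' \<le> k"
  shows "W i' (m i') \<le> W i 1"
  using assms(1,3)
proof (induction i')
  case (Suc i')
  show ?case
  proof (cases "i = i'")
    case True
    then show ?thesis using W_last_le_first[of i] Suc assms(2) by auto
  next
    case False
    then have "W (Suc i') (m (Suc i')) \<le> W i' 1" "W i' (m i') \<le> W i 1"
      using W_last_le_first[of i'] Suc assms(2) by auto
    then show ?thesis using W_first_le_last[of i'] Suc False assms(2) by auto
  qed
qed simp

text \<open>The row increases, so the \<open>j\<close> with \<open>W i j < b\<close> form an initial
  segment \<open>1..t\<close>; the parity of \<open>t\<close> decides between the two
  values.\<close>

lemma alt_sum_cases:
  assumes i: "i \<in> {1..k}"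
  shows "alt_sum i b = 0 \<or> alt_sum i b = - 1"
proof -
  have "\<exists>t\<le>M. \<forall>j\<in>{1..M}. W i j < b \<longleftrightarrow> j \<le> t" if "M \<le> m i" for M
    using that
  proof (induction M)
    case (Suc M)
    then obtain t where t: "t \<le> M" "\<forall>j\<in>{1..M}. W i j < b \<longleftrightarrow> j \<le> t" by auto
    show ?case
    proof (cases "W i (Suc M) < b")
      case True
      have "W i j < b" if "j \<in> {1..Suc M}" for j
        using that True W_mono[OF i, of j "Suc M"] Suc.prems by (cases "j = Suc M") force+
      then show ?thesis by (intro exI[of _ "Suc M"]) auto
    next
      case False
      then show ?thesis using t by (intro exI[of _ t]) (auto simp: le_Suc_eq)
    qed
  qed simp
  from this[of "m i"] obtain t where t: "t \<le> m i" "\<forall>j\<in>{1..m i}. W i j < b \<longleftrightarrow> j \<le> t" by auto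
  have "alt_sum i b = (\<Sum>j\<in>{1..m i}. if j \<in> {1..t} then (- 1) ^ j else 0)"
    unfolding alt_sum_def using t by (intro sum.cong) auto
  also have "\<dots> = (\<Sum>j\<in>{1..m i} \<inter> {1..t}. (- 1) ^ j)"
    by (subst sum.inter_restrict) auto
  also have "{1..m i} \<inter> {1..t} = {1..t}" using t by auto
  finally show ?thesis unfolding alternating_sum by (simp split: if_splits)
qed

lemma sum_alternating_m: "i \<in> {1..k} \<Longrightarrow> (\<Sum>j = 1..m i. (- 1) ^ j) = (- 1 :: real)"
  unfolding alternating_sum using odd_m[of i] by simp

lemma alt_sum_eq_0:
  assumes "i \<in> {1..k}" "b \<le> W i 1"
  shows "alt_sum i b = 0"
  unfolding alt_sum_def using W_bounds(1)[OF assms(1)] assms(2)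
  by (intro sum.neutral) (force simp: not_less[symmetric])

lemma alt_sum_eq_m1:
  assumes "i \<in> {1..k}" "W i (m i) < b"
  shows "alt_sum i b = - 1"
proof -
  have "alt_sum i b = (\<Sum>j = 1..m i. (- 1) ^ j)"
    unfolding alt_sum_def using W_bounds(2)[OF assms(1)] assms(2)
    by (intro sum.cong) force+
  then show ?thesis using sum_alternating_m[OF assms(1)] by simp
qed

lemma alt_sum_first: "i \<in> {1..k} \<Longrightarrow> b \<le> Suc (V (Suc k)) \<Longrightarrow> alt_sum i b = 0"
  using V_less_W[of i 1] m_pos[of i] by (intro alt_sum_eq_0) auto

lemma alt_sum_n: "i \<in> {1..k} \<Longrightarrow> alt_sum i n = - 1"
  using W_less_n[of i "m i"] m_pos[of i] by (intro alt_sum_eq_m1) auto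

section \<open>Formulas for the weights of arcs\<close>

text \<open>Index \<open>0\<close> is split off because no row belongs to it. Every
  \<open>W i j\<close> lies to the right of \<open>V i\<close>, so once \<open>V i\<close> is in the
  arc only the right end \<open>y\<close> can cut its row.\<close>

lemma block_weight_interval:
  "block_weight {x..<y} = of_bool (x = 0 \<and> V 1 < y)
     + (\<Sum>i = 1..k. of_bool (x \<le> V i) * (of_bool (V (Suc i) < y) + alt_sum i y))"
proof -
  have pairs: "(\<Sum>i = 0..k. of_bool (V i \<in> {x..<y} \<and> V (Suc i) \<in> {x..<y})) =
      (of_bool (x = 0 \<and> V 1 < y) :: real) + (\<Sum>i = 1..k. of_bool (x \<le> V i \<and> V (Suc i) < y))"
    using V_less_Suc[of 0]
    by (subst sum.atLeast_Suc_atMost, simp, intro arg_cong2[of _ _ _ _ "(+)"] sum.cong arg_cong[of _ _ of_bool])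
      (use V_0 V_less_Suc in \<open>force+\<close>)
  have "(\<Sum>j = 1..m i. (- 1) ^ j * of_bool (V i \<in> {x..<y} \<and> W i j \<in> {x..<y}))
      = of_bool (x \<le> V i) * alt_sum i y" if i: "i \<in> {1..k}" for i
    unfolding alt_sum_def sum_distrib_left
  proof (intro sum.cong refl)
    fix j assume j: "j \<in> {1..m i}"
    show "(- 1) ^ j * of_bool (V i \<in> {x..<y} \<and> W i j \<in> {x..<y}) =
      of_bool (x \<le> V i) * ((- 1) ^ j * of_bool (W i j < y) :: real)"
      using V_less_W[OF i j] V_le_last[of i] i by (cases "x \<le> V i"; cases "W i j < y") auto
  qed
  then have "(\<Sum>i = 1..k. \<Sum>j = 1..m i. (- 1) ^ j * of_bool (V i \<in> {x..<y} \<and> W i j \<in> {x..<y}))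
      = (\<Sum>i = 1..k. of_bool (x \<le> V i) * alt_sum i y)"
    by (intro sum.cong) auto
  then show ?thesis
    unfolding block_weight_def pairs by (simp only: of_bool_conj distrib_left sum.distrib add.assoc)
qed

text \<open>A wrapping arc keeps the entries of a row below \<open>y\<close> and from
  \<open>x\<close> on; as \<open>m i\<close> is odd, they sum to
  \<open>alt_sum i y - 1 - alt_sum i x\<close>. After an index shift on the low side, each row with
  \<open>V i\<close> in the arc is matched with a path pair whose \<open>1\<close> cancels the
  \<open>- 1\<close>.\<close>

lemma block_weight_outer:
  assumes "y \<le> x"
  shows "block_weight ({..<y} \<union> {x..<n}) = of_bool (V (Suc k) < y) + of_bool (x = 0)
     + (\<Sum>i = 0..k. of_bool (V i < y \<and> x \<le> V (Suc i)))
     + (\<Sum>i = 1..k. (of_bool (V i < y) + of_bool (x \<le> V i)) * (alt_sum i y - alt_sum i x))"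
proof -
  let ?B = "{..<y} \<union> {x..<n}"
  have Vn: "V i < n" if "i \<le> Suc k" for i using V_le_last[OF that] V_less_n by simp
  have "(\<Sum>i = 0..k. of_bool (V i \<in> ?B \<and> V (Suc i) \<in> ?B) :: real) =
     (\<Sum>i = 0..k. of_bool (V (Suc i) < y) + of_bool (x \<le> V i) + of_bool (V i < y \<and> x \<le> V (Suc i)))"
  proof (intro sum.cong refl)
    fix i assume "i \<in> {0..k}"
    then show "(of_bool (V i \<in> ?B \<and> V (Suc i) \<in> ?B) :: real) =
      of_bool (V (Suc i) < y) + of_bool (x \<le> V i) + of_bool (V i < y \<and> x \<le> V (Suc i))"
      using V_less_Suc[of i] Vn[of i] Vn[of "Suc i"] assms by (auto simp: of_bool_def)
  qed
  also have "\<dots> = (\<Sum>i = 0..k. of_bool (V (Suc i) < y)) + (\<Sum>i = 0..k. of_bool (x \<le> V i))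
      + (\<Sum>i = 0..k. of_bool (V i < y \<and> x \<le> V (Suc i)))"
    by (simp only: sum.distrib)
  also have "(\<Sum>i = 0..k. of_bool (V (Suc i) < y) :: real) = (\<Sum>i = 1..k. of_bool (V i < y)) + of_bool (V (Suc k) < y)"
    using sum.shift_bounds_cl_Suc_ivl[of "\<lambda>i. of_bool (V i < y) :: real" 0 k] by simp
  also have "(\<Sum>i = 0..k. of_bool (x \<le> V i) :: real) = of_bool (x = 0) + (\<Sum>i = 1..k. of_bool (x \<le> V i))"
    by (subst sum.atLeast_Suc_atMost) (simp_all add: V_0 del: sum_of_bool_eq)
  finally have pairs: "(\<Sum>i = 0..k. of_bool (V i \<in> ?B \<and> V (Suc i) \<in> ?B) :: real) =
     of_bool (V (Suc k) < y) + of_bool (x = 0) + (\<Sum>i = 0..k. of_bool (V i < y \<and> x \<le> V (Suc i)))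
     + (\<Sum>i = 1..k. of_bool (V i < y) + of_bool (x \<le> V i))"
    by (simp add: sum.distrib)
  have "(\<Sum>j = 1..m i. (- 1) ^ j * of_bool (V i \<in> ?B \<and> W i j \<in> ?B)) + (of_bool (V i < y) + of_bool (x \<le> V i))
      = (of_bool (V i < y) + of_bool (x \<le> V i)) * (alt_sum i y - alt_sum i x)" if i: "i \<in> {1..k}" for i
  proof -
    have "(\<Sum>j = 1..m i. (- 1) ^ j * of_bool (V i \<in> ?B \<and> W i j \<in> ?B) :: real)
      = (\<Sum>j = 1..m i. (of_bool (V i < y) + of_bool (x \<le> V i))
           * ((- 1) ^ j * of_bool (W i j < y) + (- 1) ^ j - (- 1) ^ j * of_bool (W i j < x)))"
    proof (intro sum.cong refl)
      fix j assume j: "j \<in> {1..m i}"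
      show "(- 1) ^ j * of_bool (V i \<in> ?B \<and> W i j \<in> ?B) =
        (of_bool (V i < y) + of_bool (x \<le> V i))
           * ((- 1) ^ j * of_bool (W i j < y) + (- 1) ^ j - (- 1) ^ j * of_bool (W i j < x) :: real)"
        using W_less_n[OF i j] Vn[of i] i assms
        by (cases "V i < y"; cases "x \<le> V i"; cases "W i j < y"; cases "W i j < x") auto
    qed
    also have "\<dots> = (of_bool (V i < y) + of_bool (x \<le> V i)) * (alt_sum i y - 1 - alt_sum i x)"
      using sum_alternating_m[OF i]
      unfolding sum_distrib_left[symmetric] alt_sum_def sum_subtractf sum.distrib by simp
    finally show ?thesis using assms by (cases "V i < y"; cases "x \<le> V i") auto
  qed
  then have "(\<Sum>i = 1..k. \<Sum>j = 1..m i. (- 1) ^ j * of_bool (V i \<in> ?B \<and> W i j \<in> ?B)) +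
      (\<Sum>i = 1..k. of_bool (V i < y) + of_bool (x \<le> V i)) =
      (\<Sum>i = 1..k. (of_bool (V i < y) + of_bool (x \<le> V i)) * (alt_sum i y - alt_sum i x))"
    unfolding sum.distrib[symmetric] by (intro sum.cong) auto
  then show ?thesis unfolding block_weight_def pairs by simp
qed

section \<open>Nonnegativity of the weights\<close>

text \<open>A row can contribute \<open>- 1\<close> only if \<open>y\<close> lies beyond
  \<open>V (Suc k)\<close>, and then the path pair \<open>V i\<close>, \<open>V (Suc i)\<close> pays
  for it.\<close>

lemma block_weight_interval_nonneg: "0 \<le> block_weight {x..<y}"
proof -
  have "0 \<le> of_bool (V (Suc i) < y) + alt_sum i y" if i: "i \<in> {1..k}" for i
  proof (cases "V (Suc i) < y")
    case True
    then show ?thesis using alt_sum_cases[OF i, of y] by auto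
  next
    case False
    then show ?thesis using alt_sum_first[OF i, of y] V_le_last[of "Suc i"] i by auto
  qed
  then have "0 \<le> (\<Sum>i = 1..k. of_bool (x \<le> V i) * (of_bool (V (Suc i) < y) + alt_sum i y))"
    by (intro sum_nonneg mult_nonneg_nonneg) simp_all
  then show ?thesis unfolding block_weight_interval by simp
qed

text \<open>If \<open>y\<close> does not pass \<open>V (Suc k)\<close>, no term is negative.
  Otherwise \<open>of_bool (V (Suc k) < y)\<close> pays for one negative row, and there is no second
  one.\<close>

lemma block_weight_outer_nonneg:
  assumes "y \<le> x"
  shows "0 \<le> block_weight ({..<y} \<union> {x..<n})"
proof -
  have "0 \<le> of_bool (V (Suc k) < y)
     + (\<Sum>i = 1..k. (of_bool (V i < y) + of_bool (x \<le> V i)) * (alt_sum i y - alt_sum i x))"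
  proof (cases "V (Suc k) < y")
    case False
    have "0 \<le> (of_bool (V i < y) + of_bool (x \<le> V i)) * (alt_sum i y - alt_sum i x)" if i: "i \<in> {1..k}" for i
      using alt_sum_first[OF i, of y] alt_sum_cases[OF i, of x] False by auto
    then have "0 \<le> (\<Sum>i = 1..k. (of_bool (V i < y) + of_bool (x \<le> V i)) * (alt_sum i y - alt_sum i x))"
      by (intro sum_nonneg) auto
    then show ?thesis by simp
  next
    case True
    have Vy: "V i < y" if "i \<in> {1..k}" for i using V_le_last[of i] True that by auto
    \<comment> \<open>The rows contributing \<open>- 1\<close>. They satisfy
      \<open>W i 1 < y \<le> x \<le> W i (m i)\<close>, which cannot hold for two rows because a
      later row ends before an earlier one starts, up to a common endpoint.\<close>
    define N where "N = {i \<in> {1..k}. alt_sum i y = - 1 \<and> alt_sum i x = 0}"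
    have N: "W i 1 < y" "x \<le> W i (m i)" if "i \<in> N" for i
      using that alt_sum_eq_0[of i y] alt_sum_eq_m1[of i x] unfolding N_def
      by (auto simp: not_le[symmetric] simp del: not_le)
    have "i = i'" if "i \<in> N" "i' \<in> N" for i i'
    proof -
      have "\<not> i < i'" if "i \<in> N" "i' \<in> N" for i i'
        using W_last_le_first_less[of i i'] N(1)[OF that(1)] N(2)[OF that(2)] that assms
        unfolding N_def by auto
      then show ?thesis using that by (meson linorder_neqE_nat)
    qed
    then have "card N \<le> 1" by (intro card_le_Suc0_iff_eq[THEN iffD2, simplified One_nat_def[symmetric]]) (auto simp: N_def)
    have "- real (card N) = (\<Sum>i = 1..k. if i \<in> N then - 1 else 0)"
      by (subst sum.inter_restrict[symmetric]) (auto simp: N_def Int_def conj_commute cong: conj_cong)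
    also have "\<dots> \<le> (\<Sum>i = 1..k. (of_bool (V i < y) + of_bool (x \<le> V i)) * (alt_sum i y - alt_sum i x))"
    proof (intro sum_mono)
      fix i assume i: "i \<in> {1..k}"
      show "(if i \<in> N then - 1 else 0) \<le> (of_bool (V i < y) + of_bool (x \<le> V i)) * (alt_sum i y - alt_sum i x)"
        using alt_sum_cases[OF i, of y] alt_sum_cases[OF i, of x] Vy[OF i] i assms unfolding N_def by auto
    qed
    finally show ?thesis using \<open>card N \<le> 1\<close> True by simp
  qed
  moreover have "0 \<le> (\<Sum>i = 0..k. of_bool (V i < y \<and> x \<le> V (Suc i)) :: real)"
    by (intro sum_nonneg) simp
  ultimately show ?thesis unfolding block_weight_outer[OF assms] by (smt (verit) of_bool_eq_0_iff of_bool_eq_1_iff)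
qed

section \<open>Arcs of weight zero\<close>

lemma block_weight_interval_eq_0:
  assumes "y \<le> Suc (V (Suc k))" "\<And>i. i \<le> k \<Longrightarrow> x \<le> V i \<Longrightarrow> y \<le> V (Suc i)"
  shows "block_weight {x..<y} = 0"
proof -
  have "of_bool (x \<le> V i) * (of_bool (V (Suc i) < y) + alt_sum i y) = 0" if i: "i \<in> {1..k}" for i
    using alt_sum_first[OF i assms(1)] assms(2)[of i] i by auto
  then show ?thesis unfolding block_weight_interval
    using assms(2)[of 0] V_0 by (cases "x = 0") auto
qed

text \<open>\<open>0 < x\<close> excludes the pair at \<open>V 0\<close>; in every row with
  \<open>V i\<close> in the arc, the path pair and the alternating sum cancel.\<close>

lemma block_weight_interval_eq_0':
  assumes "0 < x" "V (Suc k) < y" "\<And>i. i \<in> {1..k} \<Longrightarrow> x \<le> V i \<Longrightarrow> alt_sum i y = - 1"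
  shows "block_weight {x..<y} = 0"
proof -
  have "of_bool (x \<le> V i) * (of_bool (V (Suc i) < y) + alt_sum i y) = 0" if i: "i \<in> {1..k}" for i
    using assms(3)[OF i] V_le_last[of "Suc i"] i assms(2) by auto
  then show ?thesis unfolding block_weight_interval using assms(1) by simp
qed

text \<open>The gap contains \<open>V r\<close>, so no path pair bridges it. All
  \<open>W i j\<close> are in the arc, and each row with \<open>V i\<close> in the arc cancels one
  path pair by its full sum \<open>- 1\<close>.\<close>

lemma block_weight_outer_eq_0:
  assumes "y \<le> V r" "V r < x" "r \<le> Suc k" "x \<le> V (Suc k)"
  shows "block_weight ({..<y} \<union> {x..<n}) = 0"
proof -
  have "\<not> (V i < y \<and> x \<le> V (Suc i))" if "i \<in> {0..k}" for i
  proof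
    assume i: "V i < y \<and> x \<le> V (Suc i)"
    then have "i < r" "r < Suc i" using V_mono_le[of r i] V_mono_le[of "Suc i" r] that assms
      by (meson atLeastAtMost_iff le_SucI leD le_less_trans less_le_trans not_less)+
    then show False by simp
  qed
  then show ?thesis
    using assms alt_sum_first by (subst block_weight_outer) auto
qed

text \<open>\<open>V (Suc k)\<close> lies in the gap, so only path pairs below \<open>y\<close>
  count. By the third condition, each row starting at a \<open>V i\<close> below \<open>y\<close>
  still has sum \<open>- 1\<close> from \<open>x\<close> on.\<close>

lemma block_weight_outer_eq_0':
  assumes "V (Suc k) < x" "y \<le> V (Suc k)" "\<And>i. i \<in> {1..k} \<Longrightarrow> V i < y \<Longrightarrow> alt_sum i x = 0"
  shows "block_weight ({..<y} \<union> {x..<n}) = 0"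
proof -
  have "\<not> x \<le> V (Suc i)" if "i \<in> {0..k}" for i
    using V_le_last[of "Suc i"] that assms by auto
  moreover have "(of_bool (V i < y) + of_bool (x \<le> V i)) * (alt_sum i y - alt_sum i x) = 0" if i: "i \<in> {1..k}" for i
    using V_le_last[of i] i assms alt_sum_first[OF i, of y] by auto
  ultimately show ?thesis
    using assms by (subst block_weight_outer) (auto simp del: sum_of_bool_eq mult_eq_0_iff intro!: sum.neutral)
qed

lemma V_segment:
  assumes "V 1 \<le> a" "a \<le> V k" "1 \<le> k"
  obtains i where "i \<in> {1..k}" "V i \<le> a" "a < V (Suc i)"
proof -
  define i where "i = Max {i \<in> {1..k}. V i \<le> a}"
  have i: "i \<in> {i \<in> {1..k}. V i \<le> a}" unfolding i_def using assms by (intro Max_in) auto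
  moreover have "a < V (Suc i)"
  proof (rule ccontr)
    assume *: "\<not> a < V (Suc i)"
    then have "i \<noteq> k" using assms V_less_Suc[of k] by auto
    then have "Suc i \<in> {i \<in> {1..k}. V i \<le> a}" using i * by auto
    then have "Suc i \<le> i" unfolding i_def by (intro Max_ge) auto
    then show False by simp
  qed
  ultimately show ?thesis using that by auto
qed

end

subsection \<open>Equations satisfied by the face\<close>

text \<open>\<open>C\<close> holds the coefficients of a linear equation valid on the face, and \<open>Q B\<close> is the sum of
  those of the pairs inside \<open>B\<close>.\<close>

locale star_glider_equation = star_glider +
  fixes C :: "nat \<Rightarrow> nat \<Rightarrow> real" and Q :: "nat set \<Rightarrow> real"
  assumes C_sym: "C a b = C b a"
    and Q_insert: "a < n \<Longrightarrow> B \<subseteq> {..<n} \<Longrightarrow> a \<notin> B \<Longrightarrow> Q (insert a B) = Q B + (\<Sum>b\<in>B. C a b)"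
    and Q_interval: "y \<le> n \<Longrightarrow> block_weight {x..<y} = 0 \<Longrightarrow> Q {x..<y} = 0"
    and Q_outer: "y \<le> x \<Longrightarrow> x \<le> n \<Longrightarrow> block_weight ({..<y} \<union> {x..<n}) = 0 \<Longrightarrow> Q ({..<y} \<union> {x..<n}) = 0"
    and C_first: "C (V 0) (V 1) = 0"
begin

section \<open>Single entries from four nested arcs\<close>

text \<open>Inclusion-exclusion: \<open>C a b\<close> is the signed sum of \<open>Q\<close> over the
  four sets obtained from \<open>B\<close> by adding any of \<open>a\<close> and
  \<open>b\<close>.\<close>

lemma C_four_sets:
  assumes "a < n" "b < n" "a \<noteq> b" "B \<subseteq> {..<n}" "a \<notin> B" "b \<notin> B"
    and "Q B = 0" "Q (insert a B) = 0" "Q (insert b B) = 0" "Q (insert a (insert b B)) = 0"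
  shows "C a b = 0"
proof -
  have fin: "finite B" using assms(4) finite_subset by blast
  have "(\<Sum>b\<in>B. C a b) = 0" using Q_insert[of a B] assms by simp
  moreover have "(\<Sum>b\<in>insert b B. C a b) = 0" using Q_insert[of a "insert b B"] assms by simp
  ultimately show ?thesis using fin assms by simp
qed

lemma C_inner:
  assumes "a < b" "b < n"
    and "\<And>x y. x \<in> {a, Suc a} \<Longrightarrow> y \<in> {b, Suc b} \<Longrightarrow> block_weight {x..<y} = 0"
  shows "C a b = 0"
proof (rule C_four_sets[where B = "{Suc a..<b}"])
  have eqs: "insert a {Suc a..<b} = {a..<b}" "insert b {Suc a..<b} = {Suc a..<Suc b}"
    "insert a {Suc a..<Suc b} = {a..<Suc b}" using assms by auto
  show "Q {Suc a..<b} = 0" "Q (insert a {Suc a..<b}) = 0" "Q (insert b {Suc a..<b}) = 0"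
    "Q (insert a (insert b {Suc a..<b})) = 0"
    unfolding eqs using assms by (auto intro!: Q_interval)
qed (use assms in auto)

lemma C_outer:
  assumes "a < b" "b < n"
    and "\<And>x y. y \<in> {a, Suc a} \<Longrightarrow> x \<in> {b, Suc b} \<Longrightarrow> block_weight ({..<y} \<union> {x..<n}) = 0"
  shows "C a b = 0"
proof (rule C_four_sets[where B = "{..<a} \<union> {Suc b..<n}"])
  have eqs: "insert a ({..<a} \<union> {Suc b..<n}) = {..<Suc a} \<union> {Suc b..<n}"
    "insert b ({..<a} \<union> {Suc b..<n}) = {..<a} \<union> {b..<n}"
    "insert a ({..<a} \<union> {b..<n}) = {..<Suc a} \<union> {b..<n}" using assms by auto
  show "Q ({..<a} \<union> {Suc b..<n}) = 0" "Q (insert a ({..<a} \<union> {Suc b..<n})) = 0"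
    "Q (insert b ({..<a} \<union> {Suc b..<n})) = 0"
    "Q (insert a (insert b ({..<a} \<union> {Suc b..<n}))) = 0"
    unfolding eqs using assms by (auto intro!: Q_outer)
qed (use assms in auto)

text \<open>If no path pair lies between \<open>a\<close> and \<open>b\<close>, the four inner arcs
  have weight zero. Otherwise some \<open>V r\<close> lies strictly between them, as they are not
  themselves a path pair, and the outer arcs omit \<open>V r\<close>.\<close>

lemma C_low:
  assumes "a < b" "b \<le> V (Suc k)" "\<And>i. i \<le> k \<Longrightarrow> \<not> (a = V i \<and> b = V (Suc i))"
  shows "C a b = 0"
proof (cases "\<exists>i\<le>k. a \<le> V i \<and> V (Suc i) \<le> b")
  case False
  show ?thesis
  proof (rule C_inner)
    fix x y assume xy: "x \<in> {a, Suc a}" "y \<in> {b, Suc b}"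
    have "y \<le> V (Suc i)" if "i \<le> k" "x \<le> V i" for i
    proof -
      have "\<not> V (Suc i) \<le> b" using False that xy by auto
      then show ?thesis using xy by auto
    qed
    then show "block_weight {x..<y} = 0"
      using xy assms by (intro block_weight_interval_eq_0) auto
  qed (use assms V_less_n in auto)
next
  case True
  then obtain i where i: "i \<le> k" "a \<le> V i" "V (Suc i) \<le> b" by auto
  obtain r where r: "r \<le> Suc k" "a < V r" "V r < b"
  proof (cases "a = V i")
    case True
    then show ?thesis using that[of "Suc i"] assms(3)[of i] i V_less_Suc[of i] by auto
  next
    case False
    then show ?thesis using that[of i] i V_less_Suc[of i] by auto
  qed
  show ?thesis
  proof (rule C_outer)
    fix x y assume xy: "y \<in> {a, Suc a}" "x \<in> {b, Suc b}"
    show "block_weight ({..<y} \<union> {x..<n}) = 0"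
    proof (cases "x \<le> V (Suc k)")
      case True
      then show ?thesis using xy r by (intro block_weight_outer_eq_0[of y r x]) auto
    next
      case False
      \<comment> \<open>The gap now reaches one past \<open>V (Suc k)\<close>, but still contains no
        \<open>W i j\<close>.\<close>
      then have "x = Suc (V (Suc k))" using xy assms by auto
      then show ?thesis using xy assms by (intro block_weight_outer_eq_0' alt_sum_first) auto
    qed
  qed (use assms V_less_n in auto)
qed

lemma C_low_sum:
  assumes "A \<subseteq> {..V (Suc k)}" "a \<le> V (Suc k)" "a \<notin> A"
    and "\<And>i. i \<le> k \<Longrightarrow> a = V i \<Longrightarrow> V (Suc i) \<notin> A" "\<And>i. i \<le> k \<Longrightarrow> a = V (Suc i) \<Longrightarrow> V i \<notin> A"
  shows "(\<Sum>p\<in>A. C a p) = 0"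
proof (intro sum.neutral ballI)
  fix p assume p: "p \<in> A"
  show "C a p = 0"
  proof (cases "a < p")
    case True
    then show ?thesis using assms p by (intro C_low) auto
  next
    case False
    then have "p < a" using assms(3) p by (cases "p = a") auto
    then have "C p a = 0" using assms p by (intro C_low) auto
    then show ?thesis by (simp add: C_sym)
  qed
qed

section \<open>Sums of entries at one node\<close>

text \<open>The arcs that end just before and at \<open>a\<close> both have weight zero, and their
  \<open>Q\<close> values differ by the sum of \<open>C a p\<close> over the smaller one.\<close>

lemma row_outer:
  assumes "a \<le> V k" "V (Suc k) < b" "b \<le> n"
    and "\<And>i. i \<in> {1..k} \<Longrightarrow> V i \<le> a \<Longrightarrow> alt_sum i b = 0"
  shows "(\<Sum>p<a. C a p) + (\<Sum>p = b..<n. C a p) = 0"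
proof -
  have a: "a < V (Suc k)" using assms(1) V_less_Suc[of k] by simp
  have "Q (insert a ({..<a} \<union> {b..<n})) = Q ({..<a} \<union> {b..<n}) + (\<Sum>p\<in>{..<a} \<union> {b..<n}. C a p)"
    using a assms by (intro Q_insert) auto
  moreover have "Q ({..<a} \<union> {b..<n}) = 0"
    using a assms by (intro Q_outer block_weight_outer_eq_0') auto
  moreover have "Q ({..<Suc a} \<union> {b..<n}) = 0"
    using a assms by (intro Q_outer block_weight_outer_eq_0') auto
  moreover have "insert a ({..<a} \<union> {b..<n}) = {..<Suc a} \<union> {b..<n}" by auto
  moreover have "(\<Sum>p\<in>{..<a} \<union> {b..<n}. C a p) = (\<Sum>p<a. C a p) + (\<Sum>p = b..<n. C a p)"
    using a assms by (intro sum.union_disjoint) auto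
  ultimately show ?thesis by simp
qed

lemma row_inner:
  assumes "0 < a" "a \<le> V k" "V (Suc k) < b" "b \<le> n"
    and "\<And>i. i \<in> {1..k} \<Longrightarrow> a \<le> V i \<Longrightarrow> alt_sum i b = - 1"
  shows "(\<Sum>p = Suc a..V (Suc k). C a p) + (\<Sum>p = Suc (V (Suc k))..<b. C a p) = 0"
proof -
  have a: "a < V (Suc k)" using assms(2) V_less_Suc[of k] by simp
  have "Q (insert a {Suc a..<b}) = Q {Suc a..<b} + (\<Sum>p\<in>{Suc a..<b}. C a p)"
    using a assms V_less_n by (intro Q_insert) auto
  moreover have "Q {Suc a..<b} = 0"
    using a assms by (intro Q_interval block_weight_interval_eq_0') auto
  moreover have "Q {a..<b} = 0"
    using a assms by (intro Q_interval block_weight_interval_eq_0') auto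
  moreover have "insert a {Suc a..<b} = {a..<b}" using a assms by auto
  moreover have "(\<Sum>p\<in>{Suc a..<b}. C a p) = (\<Sum>p\<in>{Suc a..V (Suc k)} \<union> {Suc (V (Suc k))..<b}. C a p)"
    using a assms by (intro sum.cong) auto
  moreover have "\<dots> = (\<Sum>p = Suc a..V (Suc k). C a p) + (\<Sum>p = Suc (V (Suc k))..<b. C a p)"
    using a assms by (intro sum.union_disjoint) auto
  ultimately show ?thesis by simp
qed

lemma row_outer_V:
  assumes i: "i \<in> {1..k}" and "V (Suc k) < b" "b \<le> n" "alt_sum i b = 0"
  shows "C (V (i - 1)) (V i) + (\<Sum>p = b..<n. C (V i) p) = 0"
proof -
  have V: "V (i - 1) < V i" using V_mono[of "i - 1" i] i by auto
  have "(\<Sum>p<V i. C (V i) p) + (\<Sum>p = b..<n. C (V i) p) = 0"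
  proof (rule row_outer)
    \<comment> \<open>\<open>alt_sum i b = 0\<close> bounds \<open>b\<close> by
      \<open>W i (m i)\<close>, hence by the start of every earlier row, whose partial sum at
      \<open>b\<close> is then \<open>0\<close> as well.\<close>
    fix i' assume i': "i' \<in> {1..k}" "V i' \<le> V i"
    then have "i' \<le> i" using V_mono[of i i'] i by (meson atLeastAtMost_iff le_SucI leD not_less)
    moreover have "b \<le> W i (m i)" using assms alt_sum_eq_m1[OF i, of b] by (force simp: not_le)
    ultimately show "alt_sum i' b = 0"
      using W_last_le_first_less[of i' i] i i' assms(4)
      by (cases "i' = i") (auto intro!: alt_sum_eq_0)
  qed (use assms V_mono_le[of i k] in auto)
  moreover have "(\<Sum>p\<in>{..<V i} - {V (i - 1)}. C (V i) p) = 0"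
  proof (intro C_low_sum)
    fix i' assume i': "i' \<le> k" "V i = V (Suc i')"
    then have "i = Suc i'" using V_mono[of i "Suc i'"] V_mono[of "Suc i'" i] i
      by (metis atLeastAtMost_iff le_SucI less_irrefl linorder_neqE_nat not_less_eq_eq)
    then show "V i' \<notin> {..<V i} - {V (i - 1)}" by simp
  next
    fix i' assume i': "i' \<le> k" "V i = V i'"
    then show "V (Suc i') \<notin> {..<V i} - {V (i - 1)}" using V_less_Suc[of i'] by simp
  qed (use i V_le_last[of i] in auto)
  ultimately show ?thesis using V by (simp add: sum.remove[of "{..<V i}" "V (i - 1)"] C_sym)
qed

lemma row_inner_V:
  assumes i: "i \<in> {1..k}" and "V (Suc k) < b" "b \<le> n" "alt_sum i b = - 1"
  shows "C (V i) (V (Suc i)) + (\<Sum>p = Suc (V (Suc k))..<b. C (V i) p) = 0"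
proof -
  have V: "V i < V (Suc i)" "V (Suc i) \<le> V (Suc k)" "0 < V i"
    using V_less_Suc[of i] V_le_last[of "Suc i"] V_mono[of 0 i] i by auto
  have "(\<Sum>p = Suc (V i)..V (Suc k). C (V i) p) + (\<Sum>p = Suc (V (Suc k))..<b. C (V i) p) = 0"
  proof (rule row_inner)
    \<comment> \<open>Mirror image: \<open>alt_sum i b = - 1\<close> puts \<open>b\<close> beyond
      \<open>W i 1\<close>, hence beyond the end of every later row.\<close>
    fix i' assume i': "i' \<in> {1..k}" "V i \<le> V i'"
    then have "i \<le> i'" using V_mono[of i' i] i by (meson atLeastAtMost_iff le_SucI leD not_less)
    moreover have "W i 1 < b" using assms alt_sum_eq_0[OF i, of b] by (force simp: not_le)
    ultimately show "alt_sum i' b = - 1"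
      using W_last_le_first_less[of i i'] i i' assms(4)
      by (cases "i' = i") (auto intro!: alt_sum_eq_m1)
  qed (use assms V V_mono_le[of i k] in auto)
  moreover have "(\<Sum>p\<in>{Suc (V i)..V (Suc k)} - {V (Suc i)}. C (V i) p) = 0"
  proof (intro C_low_sum)
    fix i' assume i': "i' \<le> k" "V i = V i'"
    then have "i = i'" using V_mono[of i i'] V_mono[of i' i] i
      by (metis atLeastAtMost_iff le_SucI less_irrefl linorder_neqE_nat)
    then show "V (Suc i') \<notin> {Suc (V i)..V (Suc k)} - {V (Suc i)}" by simp
  next
    fix i' assume i': "i' \<le> k" "V i = V (Suc i')"
    then show "V i' \<notin> {Suc (V i)..V (Suc k)} - {V (Suc i)}" using V_less_Suc[of i'] by simp
  qed (use V in auto)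
  ultimately show ?thesis using V by (simp add: sum.remove[of "{Suc (V i)..V (Suc k)}" "V (Suc i)"])
qed

text \<open>The sum of the entries at \<open>V (Suc i)\<close> beyond \<open>V (Suc k)\<close> is
  minus the entry of either adjacent path pair. So consecutive path entries agree, and
  \<open>C_first\<close> propagates.\<close>

lemma C_V_Suc: "i \<le> k \<Longrightarrow> C (V i) (V (Suc i)) = 0"
proof (induction i)
  case (Suc i)
  then have i: "Suc i \<in> {1..k}" by simp
  have "C (V i) (V (Suc i)) + (\<Sum>p = Suc (V (Suc k))..<n. C (V (Suc i)) p) = 0"
    using row_outer_V[OF i, of "Suc (V (Suc k))"] alt_sum_first[OF i] V_less_n by simp
  moreover have "C (V (Suc i)) (V (Suc (Suc i))) + (\<Sum>p = Suc (V (Suc k))..<n. C (V (Suc i)) p) = 0"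
    using row_inner_V[OF i, of n] alt_sum_n[OF i] V_less_n by simp
  ultimately show ?case using Suc by simp
qed (use C_first in simp)

text \<open>The remaining case is \<open>b\<close> beyond \<open>V (Suc k)\<close>. If
  \<open>a\<close> is below \<open>V 1\<close> or above \<open>V k\<close>, four arcs of weight zero
  isolate the entry; otherwise every cut \<open>c\<close> yields a zero prefix or suffix sum of the
  entries at \<open>a\<close>.\<close>

lemma C_eq_0:
  assumes "a < b" "b < n"
  shows "C a b = 0"
proof (cases "b \<le> V (Suc k)")
  case True
  then show ?thesis using assms C_V_Suc C_low by blast
next
  case b: False
  show ?thesis
  proof (cases "V 1 \<le> a \<and> a \<le> V k")
    case False
    show ?thesis
    proof (cases "V k < a")
      case True
      have "V i < a" if "i \<le> k" for i using V_mono_le[of i k] that True by simp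
      then have "block_weight {x..<y} = 0" if "x \<in> {a, Suc a}" "y \<in> {b, Suc b}" for x y
        using that b True by (intro block_weight_interval_eq_0') fastforce+
      then show ?thesis using assms by (intro C_inner) auto
    next
      case nk: False
      then have "a < V 1" using False by simp
      moreover have "V 1 \<le> V i" if "i \<in> {1..Suc k}" for i using V_mono_le[of 1 i] that by simp
      moreover have "V 1 \<le> V (Suc k)" using V_mono_le[of 1 "Suc k"] by simp
      ultimately have "block_weight ({..<y} \<union> {x..<n}) = 0"
        if "y \<in> {a, Suc a}" "x \<in> {b, Suc b}" for x y
        using that b by (intro block_weight_outer_eq_0') fastforce+
      then show ?thesis using assms by (intro C_outer) auto
    qed
  next
    case a: True
    then have k: "1 \<le> k" using V_less_Suc[of 0] V_0 by (cases k) auto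
    obtain i where i: "i \<in> {1..k}" "V i \<le> a" "a < V (Suc i)" using V_segment a k by blast
    show ?thesis
    proof (cases "a = V i")
      case True
      \<comment> \<open>With the path entries gone, the two row equations are pure suffix and prefix
        sums; the value of \<open>alt_sum i c\<close> selects the one that holds at the cut
        \<open>c\<close>.\<close>
      have "C (V (i - 1)) (V i) = 0" "C (V i) (V (Suc i)) = 0"
        using C_V_Suc[of "i - 1"] C_V_Suc[of i] i by auto
      note rows = row_outer_V[OF i(1), unfolded this] row_inner_V[OF i(1), unfolded this]
      show ?thesis
      proof (rule sums_zero_imp_zero[where s = "Suc (V (Suc k))"])
        show "(\<Sum>p = Suc (V (Suc k))..<n. C a p) = 0"
          using rows(2)[of n] alt_sum_n[OF i(1)] V_less_n True by simp
        show "(\<Sum>p = c..<n. C a p) = 0 \<or> (\<Sum>p = Suc (V (Suc k))..<c. C a p) = 0"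
          if "Suc (V (Suc k)) \<le> c" "c \<le> n" for c
          using alt_sum_cases[OF i(1), of c] rows[of c] that True by auto
      qed (use b assms in auto)
    next
      case False
      then have ai: "V i < a" using i by simp
      then have "i < k" using i a by (cases "i = k") auto
      have nV: "a \<noteq> V i'" if "i' \<le> Suc k" for i'
        using V_mono_le[of i' i] V_mono_le[of "Suc i" i'] that ai i by (cases "i' \<le> i") auto
      have a1: "a < V (Suc k)" "0 < a" using a V_less_Suc[of k] V_mono[of 0 1] by auto
      have low: "(\<Sum>p<a. C a p) = 0" "(\<Sum>p = Suc a..V (Suc k). C a p) = 0"
        using nV a1 by (intro C_low_sum; auto dest: le_SucI)+
      \<comment> \<open>\<open>W i 1\<close> separates the two kinds of cuts: rows up to
        \<open>i\<close> start no earlier than \<open>W i 1\<close>, and rows after \<open>i\<close>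
        have ended by then.\<close>
      have suf: "(\<Sum>p = c..<n. C a p) = 0" if c: "V (Suc k) < c" "c \<le> n" "c \<le> W i 1" for c
      proof -
        have "alt_sum i' c = 0" if i': "i' \<in> {1..k}" "V i' \<le> a" for i'
        proof -
          have "i' \<le> i" using V_mono_le[of "Suc i" i'] i i' by (force simp: not_le[symmetric])
          then have "c \<le> W i' 1"
            using W_last_le_first_less[of i' i] W_first_le_last[OF i(1)] i' i c by (cases "i' = i") auto
          then show ?thesis using alt_sum_eq_0 i' by simp
        qed
        then show ?thesis using row_outer[of a c] low c a by simp
      qed
      have pre: "(\<Sum>p = Suc (V (Suc k))..<c. C a p) = 0" if c: "V (Suc k) < c" "c \<le> n" "W i 1 < c" for c
      proof -
        have "alt_sum i' c = - 1" if i': "i' \<in> {1..k}" "a \<le> V i'" for i'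
        proof -
          have "i < i'" using V_mono_le[of i' i] i i' ai by (force simp: not_le[symmetric])
          then have "W i' (m i') < c"
            using W_last_le_first_less[of i i'] i' i c by auto
          then show ?thesis using alt_sum_eq_m1 i' by simp
        qed
        then show ?thesis using row_inner[of a c] low c a a1 by simp
      qed
      show ?thesis
      proof (rule sums_zero_imp_zero[where s = "Suc (V (Suc k))"])
        show "(\<Sum>p = Suc (V (Suc k))..<n. C a p) = 0"
          using suf[of "Suc (V (Suc k))"] V_less_W[OF i(1), of 1] m_pos[OF i(1)] V_less_n by simp
        show "(\<Sum>p = c..<n. C a p) = 0 \<or> (\<Sum>p = Suc (V (Suc k))..<c. C a p) = 0"
          if "Suc (V (Suc k)) \<le> c" "c \<le> n" for c
          using suf[of c] pre[of c] that by (cases "c \<le> W i 1") auto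
      qed (use b assms in auto)
    qed
  qed
qed

end

subsection \<open>Arcs of the cycle\<close>

text \<open>The coordinate of \<open>b\<close> seen from \<open>a\<close>: \<open>fwd a\<close>
  inverts \<open>\<lambda>t. a + of_nat t\<close> on the numbers below
  \<open>CARD('n)\<close>.\<close>

definition fwd :: "'n::nontriv mod_ring \<Rightarrow> 'n mod_ring \<Rightarrow> nat" where
  "fwd a b = nat (to_int_mod_ring (b - a))"

lemma to_int_mod_ring_bounds:
  fixes x :: "'n::nontriv mod_ring"
  shows "0 \<le> to_int_mod_ring x" "to_int_mod_ring x < int CARD('n)"
  using range_to_int_mod_ring[where 'a = 'n] by (metis UNIV_I atLeastLessThan_iff image_eqI)+

lemma fwd_less: "fwd a b < CARD('n)" for a b :: "'n::nontriv mod_ring"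
  using to_int_mod_ring_bounds[of "b - a"] by (auto simp: fwd_def nat_less_iff)

lemma add_fwd [simp]: "a + of_nat (fwd a b) = b" for a b :: "'n::nontriv mod_ring"
  using to_int_mod_ring_bounds[of "b - a"] by (simp add: fwd_def of_nat_of_int_mod_ring)

lemma fwd_add: "p < CARD('n) \<Longrightarrow> fwd a (a + of_nat p) = p" for a :: "'n::nontriv mod_ring"
  by (simp add: fwd_def of_nat_of_int_mod_ring)

lemma fwd_self [simp]: "fwd a a = 0"
  by (simp add: fwd_def)

lemma fwd_inject [simp]: "fwd a x = fwd a y \<longleftrightarrow> x = y"
  by (metis add_fwd)

lemma fwd_eq_0_iff: "fwd a x = 0 \<longleftrightarrow> x = a"
  by (metis fwd_self fwd_inject)

lemma fwd_diff:
  assumes "fwd z a \<le> fwd z x"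
  shows "fwd a x = fwd z x - fwd z a"
proof -
  have "x = z + of_nat (fwd z a + (fwd z x - fwd z a))" using assms by simp
  also have "\<dots> = a + of_nat (fwd z x - fwd z a)" by (simp only: of_nat_add add.assoc[symmetric] add_fwd)
  finally show ?thesis using fwd_add[of "fwd z x - fwd z a" a] fwd_less[of z x] by simp
qed

lemma fwd_swap:
  fixes a b :: "'n::nontriv mod_ring"
  assumes "a \<noteq> b"
  shows "fwd b a = CARD('n) - fwd a b"
proof -
  have "b + of_nat (CARD('n) - fwd a b) = a + of_nat (fwd a b + (CARD('n) - fwd a b))"
    by (simp only: of_nat_add add.assoc[symmetric] add_fwd)
  also have "\<dots> = a" using fwd_less[of a b] by simp
  finally have "b + of_nat (CARD('n) - fwd a b) = a" .
  moreover have "CARD('n) - fwd a b < CARD('n)" using assms fwd_eq_0_iff[of a b] by auto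
  ultimately show ?thesis using fwd_add by metis
qed

lemma mem_cyc_cc: "x \<in> cyc_cc a b \<longleftrightarrow> fwd a x \<le> fwd a b"
proof
  assume "x \<in> cyc_cc a b"
  then obtain t where "x = a + of_nat t" "t \<le> fwd a b" by (auto simp: cyc_cc_def fwd_def)
  then show "fwd a x \<le> fwd a b" using fwd_add[of t a] fwd_less[of a b] by simp
next
  assume "fwd a x \<le> fwd a b"
  then show "x \<in> cyc_cc a b"
    unfolding cyc_cc_def fwd_def[symmetric] by (intro CollectI exI[of _ "fwd a x"]) simp
qed

lemma mem_cyc_co: "x \<in> cyc_co a b \<longleftrightarrow> fwd a x < fwd a b"
  using fwd_inject[of a x b] by (auto simp: cyc_co_def mem_cyc_cc le_less simp del: fwd_inject)

text \<open>The forward way from \<open>z\<close> to \<open>x\<close> passes through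
  \<open>a\<close> without meeting \<open>z\<close> again, so distances add.\<close>

lemma fwd_cyc_oo:
  assumes "x \<in> cyc_oo a z"
  shows "fwd z x = fwd z a + fwd a x" "0 < fwd a x"
proof -
  have x: "fwd a x < fwd a z" "x \<noteq> a"
    using assms fwd_inject[of a x z] by (auto simp: cyc_oo_def mem_cyc_cc le_less simp del: fwd_inject)
  then show "0 < fwd a x" using fwd_eq_0_iff[of a x] by simp
  have "a \<noteq> z" using x by auto
  then have "fwd z a = CARD('a) - fwd a z" by (rule fwd_swap)
  moreover have "fwd z x = CARD('a) - fwd x z" using x by (intro fwd_swap) auto
  moreover have "fwd x z = fwd a z - fwd a x" using x by (intro fwd_diff) simp
  ultimately show "fwd z x = fwd z a + fwd a x" using x fwd_less[of a z] by simp
qed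

lemma mem_image_fwd: "fwd z a \<in> fwd z ` B \<longleftrightarrow> a \<in> B"
  by (auto simp: image_iff)

lemma image_fwd_add:
  fixes z :: "'n::nontriv mod_ring"
  assumes "A \<subseteq> {..<CARD('n)}"
  shows "fwd z ` (\<lambda>p. z + of_nat p) ` A = A"
  unfolding image_image using assms by (force simp: fwd_add cong: image_cong)

section \<open>Connected node sets are arcs\<close>

text \<open>\<open>y\<close> may exceed the number of nodes, so wrapping arcs are included; the path
  runs through consecutive representatives.\<close>

lemma induces_connected_arc:
  "induces_connected ((\<lambda>p. z + of_nat p) ` {x..<y})" (is "induces_connected ?B")
proof -
  let ?R = "\<lambda>a b. a \<in> ?B \<and> b \<in> ?B \<and> {a, b} \<in> cycle_edges"
  have "?R\<^sup>*\<^sup>* (z + of_nat p) (z + of_nat q) \<and> ?R\<^sup>*\<^sup>* (z + of_nat q) (z + of_nat p)"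
    if "x \<le> p" "p \<le> q" "q < y" for p q
    using that(2,3)
  proof (induction rule: dec_induct)
    case (step q)
    have "{z + of_nat q, z + of_nat (Suc q)} \<in> cycle_edges"
      unfolding cycle_edges_def by (intro CollectI exI[of _ "z + of_nat q"]) (simp add: add_ac)
    then have "?R (z + of_nat q) (z + of_nat (Suc q))" "?R (z + of_nat (Suc q)) (z + of_nat q)"
      using step that(1) by (auto simp: insert_commute simp del: of_nat_Suc)
    moreover have "?R\<^sup>*\<^sup>* (z + of_nat p) (z + of_nat q)" "?R\<^sup>*\<^sup>* (z + of_nat q) (z + of_nat p)"
      using step by auto
    ultimately show ?case
      by (intro conjI) (rule rtranclp.rtrancl_into_rtrancl converse_rtranclp_into_rtranclp, assumption+)+
  qed simp
  note path = this
  show ?thesis unfolding induces_connected_def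
  proof (intro ballI)
    fix a b assume "a \<in> ?B" "b \<in> ?B"
    then obtain p q where pq: "a = z + of_nat p" "b = z + of_nat q" "p \<in> {x..<y}" "q \<in> {x..<y}" by blast
    show "?R\<^sup>*\<^sup>* a b" unfolding pq(1,2)
      using path[of p q] path[of q p] pq(3,4) by (cases "p \<le> q") simp_all
  qed
qed

lemma induces_connected_outer:
  fixes z :: "'n::nontriv mod_ring"
  assumes "x \<le> CARD('n)"
  shows "induces_connected ((\<lambda>p. z + of_nat p) ` ({..<y} \<union> {x..<CARD('n)}))"
proof -
  \<comment> \<open>Shifting the low part by a full turn leaves its nodes unchanged and makes the
    set one interval of representatives.\<close>
  have "(\<lambda>p. z + of_nat p) ` {CARD('n)..<CARD('n) + y} = (\<lambda>p. z + of_nat p) ` (\<lambda>p. p + CARD('n)) ` {..<y}"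
    using image_add_atLeastLessThan'[of "CARD('n)" 0 y] by (simp add: lessThan_atLeast0 add.commute)
  also have "\<dots> = (\<lambda>p. z + of_nat p) ` {..<y}" unfolding image_image by simp
  finally have "(\<lambda>p. z + of_nat p) ` ({..<y} \<union> {x..<CARD('n)})
      = (\<lambda>p. z + of_nat p) ` ({x..<CARD('n)} \<union> {CARD('n)..<CARD('n) + y})"
    by (simp add: image_Un Un_commute)
  also have "{x..<CARD('n)} \<union> {CARD('n)..<CARD('n) + y} = {x..<CARD('n) + y}"
    using assms by auto
  finally show ?thesis using induces_connected_arc by metis
qed

text \<open>An edge changes the coordinate by one, except between the last position and
  \<open>0\<close>. A path inside \<open>B\<close> starting between the missing \<open>q\<close> and
  \<open>s\<close> can neither cross them nor reach the wrap-around.\<close>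

lemma induces_connected_between:
  fixes B :: "'n::nontriv mod_ring set"
  assumes "induces_connected B" "q \<notin> fwd z ` B" "s \<notin> fwd z ` B" "s < CARD('n)"
    and "r \<in> fwd z ` B" "q < r" "r < s" "p \<in> fwd z ` B"
  shows "q < p \<and> p < s"
proof -
  obtain a b where ab: "a \<in> B" "b \<in> B" "fwd z a = r" "fwd z b = p" using assms by auto
  then have "(\<lambda>x y. x \<in> B \<and> y \<in> B \<and> {x, y} \<in> cycle_edges)\<^sup>*\<^sup>* a b"
    using assms(1) by (auto simp: induces_connected_def)
  then have "q < fwd z b \<and> fwd z b < s"
  proof (induction rule: rtranclp_induct)
    case (step x y)
    have ne: "fwd z y \<noteq> q" "fwd z y \<noteq> s" using step assms by auto
    have "y = x + 1 \<or> x = y + 1" using step by (auto simp: cycle_edges_def doubleton_eq_iff)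
    then show ?case
    proof
      assume "y = x + 1"
      also have "\<dots> = z + of_nat (fwd z x + 1)" by (simp only: of_nat_add of_nat_1 add.assoc[symmetric] add_fwd)
      finally have "fwd z y = fwd z x + 1" using fwd_add[of "fwd z x + 1" z] step assms by simp
      then show ?thesis using ne step by simp
    next
      assume xy: "x = y + 1"
      have "x = z + of_nat (fwd z x - 1 + 1)" using step by simp
      also have "\<dots> = z + of_nat (fwd z x - 1) + 1" by (simp only: of_nat_add of_nat_1 add.assoc)
      finally have "y = z + of_nat (fwd z x - 1)" using xy by simp
      then have "fwd z y = fwd z x - 1" using fwd_add[of "fwd z x - 1" z] fwd_less[of z x] by simp
      then show ?thesis using ne step.IH by linarith
    qed
  qed (use ab assms in simp)
  then show ?thesis using ab by simp
qed

lemma induces_connected_cases: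
  fixes B :: "'n::nontriv mod_ring set" and z :: "'n mod_ring"
  assumes "induces_connected B"
  obtains x y where "fwd z ` B = {x..<y}"
    | x y where "y \<le> x" "fwd z ` B = {..<y} \<union> {x..<CARD('n)}"
proof -
  define X where "X = fwd z ` B"
  define M where "M = {..<CARD('n)} - X"
  have X: "X \<subseteq> {..<CARD('n)}" using fwd_less by (auto simp: X_def)
  have finM: "finite M" by (simp add: M_def)
  \<comment> \<open>If no element of \<open>X\<close> lies between the extreme missing positions,
    \<open>X\<close> wraps around; otherwise the missing positions nearest to such an element on
    both sides bound \<open>X\<close>.\<close>
  consider "M = {}" | "M \<noteq> {}" "\<And>r. r \<in> X \<Longrightarrow> \<not> (Min M < r \<and> r < Max M)"
    | r where "M \<noteq> {}" "r \<in> X" "Min M < r" "r < Max M" by blast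
  then show thesis
  proof cases
    case 1
    then have "X = {0..<CARD('n)}" using X by (auto simp: M_def)
    then show thesis using that(1) X_def by metis
  next
    case 2
    have "Min M \<in> M" "Max M \<in> M" using 2 finM by auto
    have "X = {..<Min M} \<union> {Suc (Max M)..<CARD('n)}"
    proof (intro Set.set_eqI iffI)
      fix r assume r: "r \<in> X"
      then have "r \<noteq> Min M" "r \<noteq> Max M" using \<open>Min M \<in> M\<close> \<open>Max M \<in> M\<close> by (auto simp: M_def)
      then show "r \<in> {..<Min M} \<union> {Suc (Max M)..<CARD('n)}" using 2(2)[OF r] r X by auto
    next
      fix r assume r: "r \<in> {..<Min M} \<union> {Suc (Max M)..<CARD('n)}"
      then have "r \<notin> M" using Min_le[OF finM, of r] Max_ge[OF finM, of r] by auto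
      moreover have "r < CARD('n)" using r \<open>Min M \<in> M\<close> by (auto simp: M_def)
      ultimately show "r \<in> X" by (auto simp: M_def)
    qed
    moreover have "Min M \<le> Suc (Max M)" using Max_ge[OF finM \<open>Min M \<in> M\<close>] by simp
    ultimately show thesis using that(2) X_def by metis
  next
    case 3
    define q where "q = Max {p \<in> M. p < r}"
    define s where "s = Min {p \<in> M. r < p}"
    have "Min M \<in> M" "Max M \<in> M" using 3 finM by auto
    then have q: "q \<in> {p \<in> M. p < r}" unfolding q_def using 3 finM by (intro Max_in) force+
    have s: "s \<in> {p \<in> M. r < p}" unfolding s_def using 3 finM \<open>Max M \<in> M\<close> by (intro Min_in) force+
    have qmax: "p \<le> q" if "p \<in> M" "p < r" for p unfolding q_def using that finM by (intro Max_ge) auto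
    have smin: "s \<le> p" if "p \<in> M" "r < p" for p unfolding s_def using that finM by (intro Min_le) auto
    have "X = {Suc q..<s}"
    proof (intro Set.set_eqI iffI)
      fix p assume p: "p \<in> X"
      have "q < p \<and> p < s"
        by (rule induces_connected_between[OF assms, of q z s r p]) (use p q s 3 in \<open>auto simp: M_def X_def\<close>)
      then show "p \<in> {Suc q..<s}" by simp
    next
      fix p assume p: "p \<in> {Suc q..<s}"
      then have "p \<notin> M \<or> p = r" using qmax[of p] smin[of p] by (meson atLeastLessThan_iff leD linorder_neqE_nat not_less_eq_eq)
      moreover have "p < CARD('n)" using p s by (auto simp: M_def)
      ultimately show "p \<in> X" using 3 by (auto simp: M_def)
    qed
    then show thesis using that(1) X_def by metis
  qed
qed

subsection \<open>Faces of the lifted multicut polytope\<close>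

lemma Rep_node_pair_node_pair: "a \<noteq> b \<Longrightarrow> Rep_node_pair (node_pair a b) = {a, b}"
  unfolding node_pair_def by (rule Abs_node_pair_inverse) simp

lemma node_pair_cases:
  obtains a b where "a \<noteq> b" "e = node_pair a b" "Rep_node_pair e = {a, b}"
proof -
  have "card (Rep_node_pair e) = 2" using Rep_node_pair[of e] by simp
  then obtain a b where "Rep_node_pair e = {a, b}" "a \<noteq> b" by (auto simp: card_2_iff)
  then show thesis using that[of a b] Rep_node_pair_inverse[of e] by (simp add: node_pair_def)
qed

text \<open>A pair is uncut exactly when it lies inside a block, so the complement of a lifted
  multicut is a disjoint union over the blocks; these vectors are its summands.\<close>

definition joined_vec :: "'n::nontriv mod_ring set \<Rightarrow> real ^ 'n node_pair" where
  "joined_vec B = char_vec {e. Rep_node_pair e \<subseteq> B}"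

lemma joined_vec_node_pair:
  "a \<noteq> b \<Longrightarrow> joined_vec B $ node_pair a b = of_bool (a \<in> B \<and> b \<in> B)"
  by (simp add: joined_vec_def char_vec_def Rep_node_pair_node_pair)

lemma joined_vec_singleton: "joined_vec {a} = 0"
proof (subst vec_eq_iff, intro allI)
  fix e :: "'a node_pair"
  obtain b c where "b \<noteq> c" "e = node_pair b c" by (rule node_pair_cases[of e])
  then show "joined_vec {a} $ e = 0 $ e" by (auto simp: joined_vec_node_pair)
qed

lemma joined_vec_empty: "joined_vec {} = 0"
proof (subst vec_eq_iff, intro allI)
  fix e :: "'a node_pair"
  obtain b c where "b \<noteq> c" "e = node_pair b c" by (rule node_pair_cases[of e])
  then show "joined_vec {} $ e = 0 $ e" by (auto simp: joined_vec_node_pair)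
qed

lemma joined_vec_UNIV: "joined_vec UNIV = vec 1"
  by (simp add: joined_vec_def char_vec_def vec_eq_iff)

lemma inner_joined_vec: "c \<bullet> joined_vec B = (\<Sum>e | Rep_node_pair e \<subseteq> B. c $ e)"
proof -
  have "c \<bullet> joined_vec B = (\<Sum>e\<in>UNIV. if e \<in> {e. Rep_node_pair e \<subseteq> B} then c $ e else 0)"
    unfolding joined_vec_def char_vec_def inner_vec_def by (intro sum.cong) auto
  also have "\<dots> = (\<Sum>e | Rep_node_pair e \<subseteq> B. c $ e)" by (subst sum.inter_restrict[symmetric]) auto
  finally show ?thesis .
qed

lemma inner_joined_vec_insert:
  assumes "a \<notin> B"
  shows "c \<bullet> joined_vec (insert a B) = c \<bullet> joined_vec B + (\<Sum>b\<in>B. c $ node_pair a b)"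
proof -
  have "{e. Rep_node_pair e \<subseteq> insert a B} = {e. Rep_node_pair e \<subseteq> B} \<union> node_pair a ` B" (is "?L = ?R")
  proof (intro Set.set_eqI)
    fix e :: "'a node_pair"
    obtain b d where e: "b \<noteq> d" "e = node_pair b d" "Rep_node_pair e = {b, d}" by (rule node_pair_cases[of e])
    have swap: "node_pair b d = node_pair d b" by (simp add: node_pair_def insert_commute)
    have "e \<in> node_pair a ` B \<longleftrightarrow> b = a \<and> d \<in> B \<or> d = a \<and> b \<in> B"
    proof
      assume "e \<in> node_pair a ` B"
      then obtain x where x: "x \<in> B" "e = node_pair a x" by auto
      have "Rep_node_pair (node_pair a x) = {a, x}"
        using x(1) assms by (intro Rep_node_pair_node_pair) auto
      then have "{b, d} = {a, x}" using e(3) x(2) by simp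
      then show "b = a \<and> d \<in> B \<or> d = a \<and> b \<in> B" using x(1) by (auto simp: doubleton_eq_iff)
    qed (use e(2) swap in \<open>metis image_eqI\<close>)
    note mem = this
    show "e \<in> ?L \<longleftrightarrow> e \<in> ?R"
      unfolding Un_iff mem_Collect_eq mem e(3) using e(1) by blast
  qed
  moreover have "{e. Rep_node_pair e \<subseteq> B} \<inter> node_pair a ` B = {}"
  proof -
    have "\<not> Rep_node_pair (node_pair a b) \<subseteq> B" if "b \<in> B" for b
      using that assms by (subst Rep_node_pair_node_pair) auto
    then show ?thesis by auto
  qed
  moreover have "inj_on (node_pair a) B"
  proof (rule inj_onI)
    fix x y assume "x \<in> B" "y \<in> B" "node_pair a x = node_pair a y"
    then have "{a, x} = {a, y}" using assms by (metis Rep_node_pair_node_pair)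
    then show "x = y" by (auto simp: doubleton_eq_iff)
  qed
  ultimately show ?thesis
    unfolding inner_joined_vec by (simp add: sum.union_disjoint sum.reindex del: Int_iff)
qed

lemma char_vec_lifted_multicut:
  assumes P: "partition_on UNIV P"
  shows "char_vec (lifted_multicut P) = vec 1 - (\<Sum>B\<in>P. joined_vec B)"
proof (subst vec_eq_iff, intro allI)
  fix e :: "'a node_pair"
  obtain a b where e: "a \<noteq> b" "e = node_pair a b" "Rep_node_pair e = {a, b}" by (rule node_pair_cases[of e])
  have eqI: "X = Y" if "X \<in> P" "Y \<in> P" "x \<in> X" "x \<in> Y" for X Y x
    using partition_onD2[OF P] that by (auto simp: disjoint_def)
  obtain A where A: "A \<in> P" "a \<in> A" using partition_onD1[OF P] UNIV_I by (metis UnionE)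
  obtain A' where A': "A' \<in> P" "b \<in> A'" using partition_onD1[OF P] UNIV_I by (metis UnionE)
  have "(\<Sum>B\<in>P. joined_vec B) $ e = (\<Sum>B\<in>P. if B = A then of_bool (b \<in> A) else 0)"
    unfolding sum_component
  proof (intro sum.cong refl)
    fix B assume "B \<in> P"
    then have "a \<in> B \<longleftrightarrow> B = A" using A eqI[of B A a] by auto
    then show "joined_vec B $ e = (if B = A then of_bool (b \<in> A) else 0)"
      unfolding e(2) using e(1) by (simp add: joined_vec_node_pair)
  qed
  also have "\<dots> = of_bool (b \<in> A)" using A by simp
  finally have "(\<Sum>B\<in>P. joined_vec B) $ e = of_bool (b \<in> A)" .
  moreover have "e \<in> lifted_multicut P \<longleftrightarrow> b \<notin> A"
  proof
    assume "e \<in> lifted_multicut P"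
    then obtain X Y x y where "X \<in> P" "Y \<in> P" "X \<noteq> Y" "x \<in> X" "y \<in> Y" "{a, b} = {x, y}"
      using e by (auto simp: lifted_multicut_def)
    then show "b \<notin> A" using A eqI by (metis doubleton_eq_iff)
  next
    assume "b \<notin> A"
    then show "e \<in> lifted_multicut P" using A A' e unfolding lifted_multicut_def by blast
  qed
  ultimately show "char_vec (lifted_multicut P) $ e = (vec 1 - (\<Sum>B\<in>P. joined_vec B)) $ e"
    by (simp add: char_vec_def)
qed

text \<open>Singletons contain no pair, so beside them only \<open>B\<close> is subtracted. Blocks
  are nonempty, so an empty \<open>B\<close> is replaced by a singleton, whose vector is also
  zero.\<close>

lemma block_vertex_in_LMC:
  assumes "induces_connected B"
  shows "vec 1 - joined_vec B \<in> LMC"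
proof -
  have *: "vec 1 - joined_vec B \<in> LMC" if B: "induces_connected B" "B \<noteq> {}" for B :: "'a mod_ring set"
  proof -
    define P where "P = insert B ((\<lambda>a. {a}) ` (- B))"
    have "partition_on UNIV P" using B by (auto simp: P_def partition_on_def disjoint_def)
    moreover have "induces_connected {a}" for a :: "'a mod_ring" by (simp add: induces_connected_def)
    ultimately have "decomposition P" using B by (auto simp: decomposition_def P_def)
    then have "char_vec (lifted_multicut P) \<in> LMC" unfolding LMC_def by (intro hull_inc) auto
    moreover have "(\<Sum>X\<in>P. joined_vec X) = joined_vec B + (\<Sum>X\<in>P - {B}. joined_vec X)"
      by (rule sum.remove) (auto simp: P_def)
    moreover have "(\<Sum>X\<in>P - {B}. joined_vec X) = 0"
      by (intro sum.neutral) (auto simp: P_def joined_vec_singleton)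
    ultimately show ?thesis using char_vec_lifted_multicut[OF \<open>partition_on UNIV P\<close>] by simp
  qed
  show ?thesis
  proof (cases "B = {}")
    case True
    have "induces_connected {0 :: 'a mod_ring}" by (simp add: induces_connected_def)
    then show ?thesis using *[of "{0}"] True by (simp add: joined_vec_singleton joined_vec_empty)
  qed (use * assms in blast)
qed

section \<open>A criterion for facets\<close>

text \<open>A decomposition has value \<open>1\<close> minus the sum of
  \<open>f (joined_vec B)\<close> over its blocks, so nonnegativity gives validity. By
  \<open>unique\<close>, the directions of the face and one unit vector span the space, which bounds
  the dimension of the face from below.\<close>

lemma defines_facet_LMC_I:
  fixes f :: "real ^ 'n::nontriv node_pair \<Rightarrow> real"
  assumes lin: "linear f" and f1: "f (vec 1) = 1"
    and nonneg: "\<And>B. induces_connected B \<Longrightarrow> 0 \<le> f (joined_vec B)"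
    and unique: "\<And>c. (\<And>B. induces_connected B \<Longrightarrow> f (joined_vec B) = 0 \<Longrightarrow> c \<bullet> joined_vec B = 0)
                   \<Longrightarrow> c $ e = 0 \<Longrightarrow> c = 0"
  shows "defines_facet f 1 LMC"
proof -
  define F where "F = {x \<in> LMC. f x = 1}"
  have conv: "convex (LMC :: (real ^ 'n node_pair) set)" by (simp add: LMC_def)
  define a where "a = adjoint f 1"
  have a: "f x = a \<bullet> x" for x using adjoint_works[OF lin, of x 1] by (simp add: a_def inner_commute)
  have "{char_vec (lifted_multicut P) | P. decomposition P} \<subseteq> {x. a \<bullet> x \<le> 1}"
  proof safe
    fix P :: "'n mod_ring set set" assume P: "decomposition P"
    then have "f (char_vec (lifted_multicut P)) = 1 - (\<Sum>B\<in>P. f (joined_vec B))"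
      using char_vec_lifted_multicut[of P] lin f1
      by (simp add: decomposition_def linear_diff linear_sum)
    moreover have "0 \<le> (\<Sum>B\<in>P. f (joined_vec B))"
      using P nonneg by (intro sum_nonneg) (auto simp: decomposition_def)
    ultimately show "a \<bullet> char_vec (lifted_multicut P) \<le> 1" using a by simp
  qed
  then have "LMC \<subseteq> {x. a \<bullet> x \<le> 1}" unfolding LMC_def
    by (rule hull_minimal) (rule convex_halfspace_le)
  then have le: "f x \<le> 1" if "x \<in> LMC" for x using that a by auto
  have F: "F = LMC \<inter> {x. a \<bullet> x = 1}" by (auto simp: F_def a)
  have face: "F face_of LMC" unfolding F
    using le a by (intro face_of_Int_supporting_hyperplane_le conv) auto
  have tight: "vec 1 - joined_vec B \<in> F" if "induces_connected B" "f (joined_vec B) = 0" for B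
    using block_vertex_in_LMC[OF that(1)] that(2) f1 lin by (simp add: F_def linear_diff)
  have F1: "vec 1 \<in> F" using tight[of "{}"] linear_0[OF lin]
    by (simp add: joined_vec_empty induces_connected_def)
  \<comment> \<open>The one-block decomposition gives the vector \<open>0\<close>, where
    \<open>f\<close> is \<open>0\<close> and not \<open>1\<close>, so the face is proper.\<close>
  have "induces_connected (UNIV :: 'n mod_ring set)"
  proof -
    have "(\<lambda>p. 0 + of_nat p) ` {0..<CARD('n)} = (UNIV :: 'n mod_ring set)"
    proof (rule UNIV_eq_I[symmetric])
      fix x :: "'n mod_ring"
      show "x \<in> (\<lambda>p. 0 + of_nat p) ` {0..<CARD('n)}"
        by (rule image_eqI[of _ _ "fwd 0 x"]) (simp_all add: fwd_less del: add_0)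
    qed
    then show ?thesis using induces_connected_arc[of "0 :: 'n mod_ring" 0 "CARD('n)"] by (simp only:)
  qed
  from block_vertex_in_LMC[OF this] have "0 \<in> (LMC :: (real ^ 'n node_pair) set)"
    by (simp add: joined_vec_UNIV)
  then have "F \<noteq> LMC" using linear_0[OF lin] unfolding F_def by force
  then have lt: "aff_dim F < aff_dim (LMC :: (real ^ 'n node_pair) set)"
    using face_of_aff_dim_lt conv face by blast
  \<comment> \<open>\<open>vec 1\<close> is the vertex of the decomposition into singletons; seen
    from it, a tight block gives the direction \<open>- joined_vec B\<close>.\<close>
  define D where "D = (\<lambda>x. x - vec 1) ` F"
  have dimD: "aff_dim F = int (dim D)" unfolding D_def
    using F1 by (intro aff_dim_eq_dim_subtract hull_inc)
  have "\<not> dim (insert (axis e 1) D) < DIM(real ^ 'n node_pair)"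
  proof
    assume "dim (insert (axis e 1) D) < DIM(real ^ 'n node_pair)"
    then obtain c where c: "c \<noteq> 0" "\<And>y. y \<in> span (insert (axis e 1) D) \<Longrightarrow> orthogonal c y"
      using orthogonal_to_subspace_exists by blast
    have "c \<bullet> axis e 1 = 0" using c(2)[of "axis e 1"] by (simp add: span_base orthogonal_def)
    then have "c $ e = 0" by (simp add: inner_axis)
    moreover have "c \<bullet> joined_vec B = 0" if "induces_connected B" "f (joined_vec B) = 0" for B
    proof -
      have "- joined_vec B \<in> D" using tight[OF that] unfolding D_def by (force simp: image_iff)
      then have "orthogonal c (- joined_vec B)" by (intro c(2) span_base) simp
      then show ?thesis by (simp add: orthogonal_def)
    qed
    ultimately show False using unique c(1) by blast
  qed
  then have "int DIM(real ^ 'n node_pair) \<le> aff_dim F + 1"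
    unfolding dimD by (auto simp: dim_insert split: if_splits)
  \<comment> \<open>The lower bound, properness and the ambient dimension leave no slack, which also
    makes \<open>LMC\<close> full-dimensional.\<close>
  then have "aff_dim F = aff_dim (LMC :: (real ^ 'n node_pair) set) - 1"
    using lt aff_dim_le_DIM[of "LMC :: (real ^ 'n node_pair) set"] by linarith
  then have "F facet_of LMC" unfolding facet_of_def using face F1 by blast
  then show ?thesis using le unfolding defines_facet_def F_def by blast
qed

section \<open>Translation to forward distances and conclusion\<close>

theorem theorem7p38:
  fixes v :: "nat \<Rightarrow> 'n::nontriv mod_ring"
    and w :: "nat \<Rightarrow> nat \<Rightarrow> 'n mod_ring"
    and m :: "nat \<Rightarrow> nat"
    and k :: nat
  assumes "CARD('n) \<ge> 3"
    and "k \<le> CARD('n) - 3"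
    and "inj_on v {0..k + 1}"
    and "true_to_cycle (k + 2) v"
    and "\<And>i. i \<in> {1..k} \<Longrightarrow> odd (m i)"
    and "\<And>i j. i \<in> {1..k} \<Longrightarrow> j \<in> {1..m i} \<Longrightarrow> w i j \<in> cyc_oo (v (k + 1)) (v 0)"
    and "\<And>i. i \<in> {1..k} \<Longrightarrow> inj_on (w i) {1..m i}"
    and "\<And>i. i \<in> {1..k} \<Longrightarrow> true_to_cycle (m i) (\<lambda>j. w i (j + 1))"
    \<comment> \<open>orientation convention: the whole cyclic sequence
      \<open>\<langle>v 0, \<dots>, v (k + 1), w i 1, \<dots>, w i (m i)\<rangle>\<close> is true to the cycle\<close>
    and "\<And>i. i \<in> {1..k} \<Longrightarrow>
           true_to_cycle (k + 2 + m i) (\<lambda>l. if l \<le> k + 1 then v l else w i (l - (k + 1)))"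
    and "\<And>i. i \<in> {1..<k} \<Longrightarrow> w (i + 1) (m (i + 1)) \<in> cyc_oc (v (k + 1)) (w i 1)"
  shows "defines_facet
           (\<lambda>x. (\<Sum>i = 0..k. x $ node_pair (v i) (v (i + 1)))
              + (\<Sum>i = 1..k. \<Sum>j = 1..m i. (- 1) ^ j * x $ node_pair (v i) (w i j)))
           1 (LMC :: (real ^ 'n node_pair) set)"
proof -
  let ?n = "CARD('n)"
  let ?f = "\<lambda>x :: real ^ 'n node_pair. (\<Sum>i = 0..k. x $ node_pair (v i) (v (i + 1)))
              + (\<Sum>i = 1..k. \<Sum>j = 1..m i. (- 1) ^ j * x $ node_pair (v i) (w i j))"
  define V where "V i = fwd (v 0) (v i)" for i
  define W where "W i j = fwd (v 0) (w i j)" for i j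
  define node where "node p = v 0 + of_nat p" for p
  have m_pos: "1 \<le> m i" if "i \<in> {1..k}" for i
    using assms(5)[OF that] by (cases "m i") auto
  have W_eq: "W i j = V (Suc k) + fwd (v (Suc k)) (w i j)" and VW: "V (Suc k) < W i j"
    if "i \<in> {1..k}" "j \<in> {1..m i}" for i j
    using fwd_cyc_oo[OF assms(6)[OF that]] by (simp_all add: V_def W_def)
  \<comment> \<open>The backward reading would put \<open>w i 1\<close> outside the forward interval from \<open>v (k + 1)\<close> to \<open>v 0\<close>.\<close>
  have less: "fwd (v 0) (u l) < fwd (v 0) (u (Suc l))"
    if i: "i \<in> {1..k}" and l: "Suc l < k + 2 + m i"
      and u: "u = (\<lambda>l. if l \<le> k + 1 then v l else w i (l - (k + 1)))" for i l u
  proof -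
    have "\<not> u (Suc k) \<in> cyc_oc (u (Suc (Suc k))) (u 0)"
    proof
      assume "u (Suc k) \<in> cyc_oc (u (Suc (Suc k))) (u 0)"
      then have "fwd (w i 1) (v (Suc k)) \<le> fwd (w i 1) (v 0)"
        by (simp add: u cyc_oc_def mem_cyc_cc)
      moreover have wi: "w i 1 \<in> cyc_cc (v (Suc k)) (v 0)" "w i 1 \<noteq> v (Suc k)"
        using assms(6)[OF i, of 1] m_pos[OF i] by (auto simp: cyc_oo_def)
      moreover have "fwd (w i 1) (v 0) = fwd (v (Suc k)) (v 0) - fwd (v (Suc k)) (w i 1)"
        using wi by (intro fwd_diff) (simp add: mem_cyc_cc)
      moreover have "fwd (w i 1) (v (Suc k)) = ?n - fwd (v (Suc k)) (w i 1)"
        using wi by (intro fwd_swap) auto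
      ultimately show False
        using fwd_less[of "v (Suc k)" "v 0"] by (simp add: mem_cyc_cc)
    qed
    moreover have "true_to_cycle (k + 2 + m i) u" unfolding u by (rule assms(9)[OF i])
    moreover have "Suc (Suc k) < k + 2 + m i" using m_pos[OF i] by simp
    ultimately have "\<forall>l. Suc l < k + 2 + m i \<longrightarrow> u l \<in> cyc_co (u 0) (u (Suc l))"
      unfolding true_to_cycle_def by blast
    then show ?thesis using l by (simp add: mem_cyc_co u)
  qed
  interpret star_glider ?n k V m W
  proof
    show "V 0 = 0" by (simp add: V_def)
    show "V i < V (Suc i)" if "i \<le> k" for i
    \<comment> \<open>For \<open>k = 0\<close> there is no row to feed into \<open>less\<close>; the
      distinctness of \<open>v 0\<close> and \<open>v 1\<close> suffices.\<close>
    proof (cases "k = 0")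
      case True
      then have "v 0 \<noteq> v 1" using inj_onD[OF assms(3), of 0 1] by auto
      then show ?thesis using True that fwd_eq_0_iff[of "v 0" "v 1"] by (simp add: V_def)
    next
      case False
      then show ?thesis using less[OF _ _ refl, of 1 i] that m_pos[of 1] by (simp add: V_def)
    qed
    show "W i j < W i (Suc j)" if "i \<in> {1..k}" "j \<in> {1..<m i}" for i j
      using less[OF that(1) _ refl, of "k + 1 + j"] that(2) by (simp add: W_def)
    show "W (Suc i) (m (Suc i)) \<le> W i 1" if "i \<in> {1..<k}" for i
      using assms(10)[OF that] W_eq[of i 1] W_eq[of "Suc i" "m (Suc i)"] that m_pos[of i] m_pos[of "Suc i"]
      by (simp add: cyc_oc_def mem_cyc_cc)
  qed (use fwd_less assms(5) VW in \<open>auto simp: V_def W_def\<close>)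
  have v_neq: "v i \<noteq> v (Suc i)" if "i \<le> k" for i
    using V_less_Suc[of i] that by (auto simp: V_def)
  have vw_neq: "v i \<noteq> w i j" if "i \<in> {1..k}" "j \<in> {1..m i}" for i j
    using V_le_last[of i] VW[OF that] that by (auto simp: V_def W_def)
  have f_joined: "?f (joined_vec B) = block_weight (fwd (v 0) ` B)" for B
    unfolding block_weight_def
    by (intro arg_cong2[of _ _ _ _ "(+)"] sum.cong refl)
      (simp_all add: joined_vec_node_pair v_neq vw_neq V_def W_def mem_image_fwd)
  have inj: "inj_on node {..<?n}"
    unfolding node_def by (rule inj_on_inverseI[of _ "fwd (v 0)"]) (simp add: fwd_add)
  show ?thesis
  \<comment> \<open>The coordinate set to zero is the first path pair; it supplies
    \<open>C_first\<close> below.\<close>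
  proof (rule defines_facet_LMC_I[where e = "node_pair (v 0) (v 1)"])
    show "linear ?f"
      by (intro linearI) (simp_all add: sum.distrib algebra_simps sum_distrib_left)
    \<comment> \<open>At the all-ones vector the \<open>k + 1\<close> path pairs give
      \<open>k + 1\<close>, and each of the \<open>k\<close> rows gives \<open>- 1\<close>.\<close>
    have "(\<Sum>i = 1..k. \<Sum>j = 1..m i. (- 1) ^ j) = (\<Sum>i = 1..k. - 1 :: real)"
      by (intro sum.cong sum_alternating_m) auto
    then show "?f (vec 1) = 1" by simp
    show "0 \<le> ?f (joined_vec B)" if "induces_connected B" for B
      using that block_weight_interval_nonneg block_weight_outer_nonneg
      unfolding f_joined by (cases rule: induces_connected_cases[where z = "v 0"]) auto
    fix c :: "real ^ 'n node_pair"
    assume tight: "\<And>B. induces_connected B \<Longrightarrow> ?f (joined_vec B) = 0 \<Longrightarrow> c \<bullet> joined_vec B = 0"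
      and c0: "c $ node_pair (v 0) (v 1) = 0"
    define C where "C p q = c $ node_pair (node p) (node q)" for p q
    define Q where "Q B = c \<bullet> joined_vec (node ` B)" for B
    have Q0: "Q B = 0" if "induces_connected (node ` B)" "B \<subseteq> {..<?n}" "block_weight B = 0" for B
    proof -
      have "fwd (v 0) ` node ` B = B"
        using image_fwd_add[OF that(2), of "v 0"] by (simp add: node_def[abs_def])
      then have "?f (joined_vec (node ` B)) = 0" unfolding f_joined using that(3) by simp
      then show ?thesis unfolding Q_def by (rule tight[OF that(1)])
    qed
    interpret star_glider_equation ?n k V m W C Q
    proof
      show "C a b = C b a" for a b by (simp add: C_def node_pair_def insert_commute)
      show "Q (insert a B) = Q B + (\<Sum>b\<in>B. C a b)" if "a < ?n" "B \<subseteq> {..<?n}" "a \<notin> B" for a B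
      proof -
        have "node a \<notin> node ` B" using inj_on_image_mem_iff[OF inj] that by auto
        then have "Q (insert a B) = Q B + (\<Sum>y\<in>node ` B. c $ node_pair (node a) y)"
          by (simp add: Q_def inner_joined_vec_insert)
        then show ?thesis using inj_on_subset[OF inj that(2)] by (simp add: sum.reindex C_def)
      qed
      show "Q {x..<y} = 0" if "y \<le> ?n" "block_weight {x..<y} = 0" for x y
        using that induces_connected_arc[of "v 0" x y] by (intro Q0) (auto simp: node_def[abs_def])
      show "Q ({..<y} \<union> {x..<?n}) = 0"
        if "y \<le> x" "x \<le> ?n" "block_weight ({..<y} \<union> {x..<?n}) = 0" for x y
        using that induces_connected_outer[of x "v 0" y] by (intro Q0) (auto simp: node_def[abs_def])
      show "C (V 0) (V 1) = 0" using c0 by (simp add: C_def V_def node_def)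
    qed
    show "c = 0"
    proof (subst vec_eq_iff, intro allI)
      fix e :: "'n node_pair"
      obtain a b where e: "a \<noteq> b" "e = node_pair a b" by (rule node_pair_cases[of e])
      have "fwd (v 0) a \<noteq> fwd (v 0) b" using e by simp
      then have "C (fwd (v 0) a) (fwd (v 0) b) = 0"
        using C_eq_0 C_sym fwd_less by (metis linorder_neqE_nat)
      then show "c $ e = 0 $ e" by (simp add: C_def node_def e)
    qed
  qed
qed

end
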